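(* Let $\mathcal{N}$ be a $(\mathrm{Col},\delta)$-sum-GNN with $L\ge 1$ layers, and let $r$ be a Datalog rule of the form $B_1\wedge\dots\wedge B_n\to H$ where $H$ mentions a unary predicate $U_p$, $p\in\{1,\dots,\delta\}$. Let $S$ be an arbitrary set of as many constants as there are variables in $r$. Assume that channel $p$ in $\mathcal{N}$ is safe at layer $L$. Then $r$ is sound for $T_{\mathcal{N}}$ (that is, $T_r(D)\subseteq T_{\mathcal{N}}(D)$ for each dataset $D$) if and only if $H\nu\in T_{\mathcal{N}}(D_r^{\nu})$ for each substitution $\nu$ mapping the variables of $r$ to constants in $S$ and such that $D_r^{\nu}\models B_i\nu$ for each inequality $B_i$ in $r$.
   Context: **Signature and Datalog.** Fix a finite set $\mathrm{Col}$ of colours and $\delta\in\mathbb{N}$, $\delta\geq 1$. The signature consists of unary predicates $U_1,\dots,U_\delta$ and one binary predicate $R^c$ for each $c\in\mathrm{Col}$, together with a countably infinite set of constants; there is also a countably infinite set of variables. All rules and datasets are over this signature. A term is a variable or a constant. An atom is a predicate applied to terms; a literal is an atom or an inequality $t_1\not\approx t_2$ between terms. A fact is an atom without variables; a dataset is a finite set of facts. A rule is $B_1\wedge\dots\wedge B_n\to H$ with body literals $B_i$ and head atom $H$, where every variable of the rule occurs in a body atom and each body inequality mentions two different terms. A substitution $\nu$ maps finitely many variables to constants, and $\alpha\nu$ denotes the result of applying $\nu$ to the literal $\alpha$. For a dataset $D$, write $D\models B$ for a fact $B$ if $B\in D$, and $D\models a_1\not\approx a_2$ for constants $a_1,a_2$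 if $a_1\neq a_2$. $T_r(D)$ is the set of all $H\nu$ for substitutions $\nu$ with $D\models B_i\nu$ for all $i$. For a rule $r$ and substitution $\nu$, $D_r^\nu$ is the dataset of all facts $B_i\nu$ such that $B_i$ is a body atom (not an inequality) of $r$. **Sum-GNNs.** A $(\mathrm{Col},\delta)$-graph is $\langle V,\{E^c\}_{c\in\mathrm{Col}},\lambda\rangle$ with $V$ a finite vertex set, $E^c\subseteq V\times V$, and $\lambda(v)\in\mathbb{R}^\delta$ for each $v \in V$. A $(\mathrm{Col},\delta)$-sum-GNN $\mathcal{N}$ with $L\ge1$ layers consists of dimensions $\delta_0,\dots,\delta_L$ with $\delta_0=\delta_L=\delta$ and, for each $\ell\in\{1,\dots,L\}$ and $c\in\mathrm{Col}$, real matrices $\mathbf{A}_\ell,\mathbf{B}^c_\ell$ of size $\delta_\ell\times\delta_{\ell-1}$, a vector $\mathbf{b}_\ell\in\mathbb{R}^{\delta_\ell}$, an activation function $\sigma_\ell:\mathbb{R}\to[0,\infty)$ that is monotonically increasing ($x<y$ implies $\sigma_\ell(x)\le\sigma_\ell(y)$), and a threshold $t\in\mathbb{R}$ with classification function $\mathtt{cls}_t(x)=1$ if $x\ge t$ and $0$ otherwise. Applied to a $(\mathrm{Col},\delta)$-graph it computes, for each vertex $v$, $\mathbf{v}_0=\lambda(v)$ and $$\mathbf{v}_\ell=\sigma_\ell\Big(\mathbf{b}_\ell+\mathbf{A}_\ell\mathbf{v}_{\ell-1}+\sum_{c\in\mathrm{Col}}\mathbf{B}^c_\ell\sum_{(v,u)\in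 E^c}\mathbf{u}_{\ell-1}\Big),\quad 1\le\ell\le L,$$ (functions applied element-wise). The output is the graph with the same vertices and edges, where $v$ is labelled by $\mathtt{cls}_t(\mathbf{v}_L)$. Each $i\in\{1,\dots,\delta_\ell\}$ is called a channel of layer $\ell$. **Dataset transformation.** The canonical encoding $\mathtt{enc}(D)$ of a dataset $D$ is the graph with a vertex $v_a$ for each constant $a$ in $D$, an edge $(v_a,v_b)\in E^c$ for each $R^c(a,b)\in D$, and initial labels with $p$-th component of $v_a$ equal to $1$ if $U_p(a)\in D$ and $0$ otherwise. The decoder $\mathtt{dec}$ is the inverse: it maps a Boolean-labelled graph to the set of all $R^c(a,b)$ with $(v_a,v_b)\in E^c$ and all $U_p(a)$ with $p$-th label component of $v_a$ equal to $1$. $T_{\mathcal{N}}(D)=\mathtt{dec}(\mathcal{N}(\mathtt{enc}(D)))$. **Safe channels.** All channels are safe at layer $0$. For $\ell\in\{1,\dots,L\}$, channel $i\in\{1,\dots,\delta_\ell\}$ is safe at layer $\ell$ if the $i$-th row of each of the matrices $\mathbf{A}_\ell$ and $\mathbf{B}_\ell^c$ ($c\in\mathrm{Col}$) contains only non-negative values and, additionally, the $j$-th element of each such row is zero for each $j\in\{1,\dots,\delta_{\ell-1}\}$ that is unsafe at layer $\ell-1$. Otherwise $i$ is unsafe at layer $\ell$.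
   Formalization: If r contains constants, S must avoid them and ν may map variables to constants in S or constants of r; the original fails then, e.g. for R(x,y) ∧ R(x,a) → U(x) with a network counting successors. For rules without constants the statement is unchanged. *)

theory Defs
  imports "Jordan_Normal_Form.Matrix"
begin

section \<open>Datalog\<close>

text \<open>
  Constants and variables are two disjoint countably infinite supplies.  The type
  \<open>'c\<close> is that of colours; the finite (possibly empty) set \<open>Col\<close> of colours of the
  signature and the number \<open>\<delta>\<close> of unary predicates are parameters.  Unary predicates
  and channels are numbered from \<open>0\<close> (as matrix and vector entries in the library are),
  so an index in \<open>{1, \<dots>, \<delta>}\<close> becomes an index \<open>p < \<delta>\<close>.
\<close>

type_synonym const = nat
type_synonym var = nat

datatype trm = Var var | Const const

datatype 'c atom = Unary nat trm | Binary 'c trm trm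

datatype 'c literal = Atom "'c atom" | Neq trm trm

fun trm_vars :: "trm \<Rightarrow> var set" where
  "trm_vars (Var x) = {x}"
| "trm_vars (Const a) = {}"

fun trm_consts :: "trm \<Rightarrow> const set" where
  "trm_consts (Var x) = {}"
| "trm_consts (Const a) = {a}"

fun atom_vars :: "'c atom \<Rightarrow> var set" where
  "atom_vars (Unary p t) = trm_vars t"
| "atom_vars (Binary c s t) = trm_vars s \<union> trm_vars t"

fun atom_consts :: "'c atom \<Rightarrow> const set" where
  "atom_consts (Unary p t) = trm_consts t"
| "atom_consts (Binary c s t) = trm_consts s \<union> trm_consts t"

fun literal_vars :: "'c literal \<Rightarrow> var set" where
  "literal_vars (Atom A) = atom_vars A"
| "literal_vars (Neq s t) = trm_vars s \<union> trm_vars t"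

fun literal_consts :: "'c literal \<Rightarrow> const set" where
  "literal_consts (Atom A) = atom_consts A"
| "literal_consts (Neq s t) = trm_consts s \<union> trm_consts t"

fun atom_in_sig :: "'c set \<Rightarrow> nat \<Rightarrow> 'c atom \<Rightarrow> bool" where
  "atom_in_sig Col \<delta> (Unary p t) \<longleftrightarrow> p < \<delta>"
| "atom_in_sig Col \<delta> (Binary c s t) \<longleftrightarrow> c \<in> Col"

definition is_fact :: "'c atom \<Rightarrow> bool" where
  "is_fact A \<longleftrightarrow> atom_vars A = {}"

definition is_dataset :: "'c set \<Rightarrow> nat \<Rightarrow> 'c atom set \<Rightarrow> bool" where
  "is_dataset Col \<delta> D \<longleftrightarrow> finite D \<and> (\<forall>A\<in>D. is_fact A \<and> atom_in_sig Col \<delta> A)"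

definition dataset_consts :: "'c atom set \<Rightarrow> const set" where
  "dataset_consts D = (\<Union>A\<in>D. atom_consts A)"

record 'c rule =
  body :: "'c literal list"
  head :: "'c atom"

definition rule_vars :: "'c rule \<Rightarrow> var set" where
  "rule_vars r = (\<Union>B\<in>set (body r). literal_vars B) \<union> atom_vars (head r)"

text \<open>Rules may mention constants.  A finite test set of substitutions for soundness has to
  let variables take these constants as values too: with \<open>R(x,y) \<and> R(x,a) \<rightarrow> U(x)\<close>, mapping
  \<open>y\<close> to \<open>a\<close> makes the two successors of \<open>x\<close> coincide, which a sum can detect.  For a rule
  without constants the set below is empty.\<close>

definition rule_consts :: "'c rule \<Rightarrow> const set" where
  "rule_consts r = (\<Union>B\<in>set (body r). literal_consts B) \<union> atom_consts (head r)"

definition is_rule :: "'c set \<Rightarrow> nat \<Rightarrow> 'c rule \<Rightarrow> bool" where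
  "is_rule Col \<delta> r \<longleftrightarrow>
     (\<forall>A. Atom A \<in> set (body r) \<longrightarrow> atom_in_sig Col \<delta> A) \<and>
     atom_in_sig Col \<delta> (head r) \<and>
     (\<forall>x\<in>rule_vars r. \<exists>A. Atom A \<in> set (body r) \<and> x \<in> atom_vars A) \<and>
     (\<forall>s t. Neq s t \<in> set (body r) \<longrightarrow> s \<noteq> t)"

text \<open>A substitution is a partial map with finite domain; variables outside its domain
  are left untouched.\<close>

type_synonym subst = "var \<rightharpoonup> const"

fun subst_trm :: "subst \<Rightarrow> trm \<Rightarrow> trm" where
  "subst_trm \<nu> (Var x) = (case \<nu> x of None \<Rightarrow> Var x | Some a \<Rightarrow> Const a)"
| "subst_trm \<nu> (Const a) = Const a"

fun subst_atom :: "subst \<Rightarrow> 'c atom \<Rightarrow> 'c atom" where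
  "subst_atom \<nu> (Unary p t) = Unary p (subst_trm \<nu> t)"
| "subst_atom \<nu> (Binary c s t) = Binary c (subst_trm \<nu> s) (subst_trm \<nu> t)"

fun subst_literal :: "subst \<Rightarrow> 'c literal \<Rightarrow> 'c literal" where
  "subst_literal \<nu> (Atom A) = Atom (subst_atom \<nu> A)"
| "subst_literal \<nu> (Neq s t) = Neq (subst_trm \<nu> s) (subst_trm \<nu> t)"

text \<open>Entailment is only meant for variable-free literals.  A dataset contains no
  atom with variables, and an inequality with variables is never satisfied, so that a
  substitution satisfying a rule body is defined on all variables of the rule.\<close>

fun satisfies :: "'c atom set \<Rightarrow> 'c literal \<Rightarrow> bool" where
  "satisfies D (Atom A) \<longleftrightarrow> A \<in> D"
| "satisfies D (Neq s t) \<longleftrightarrow> (\<exists>a b. s = Const a \<and> t = Const b \<and> a \<noteq> b)"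

definition T_rule :: "'c rule \<Rightarrow> 'c atom set \<Rightarrow> 'c atom set" where
  "T_rule r D = {subst_atom \<nu> (head r) | \<nu>.
     finite (dom \<nu>) \<and> (\<forall>B\<in>set (body r). satisfies D (subst_literal \<nu> B))}"

definition body_dataset :: "'c rule \<Rightarrow> subst \<Rightarrow> 'c atom set" where
  "body_dataset r \<nu> = {subst_atom \<nu> A | A. Atom A \<in> set (body r)}"


section \<open>Graphs and sum-GNNs\<close>

record ('v, 'c) graph =
  verts :: "'v set"
  edges :: "'c \<Rightarrow> ('v \<times> 'v) set"
  label :: "'v \<Rightarrow> real vec"

definition is_graph :: "'c set \<Rightarrow> nat \<Rightarrow> ('v, 'c) graph \<Rightarrow> bool" where
  "is_graph Col \<delta> G \<longleftrightarrow>
     finite (verts G) \<and>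
     (\<forall>c\<in>Col. edges G c \<subseteq> verts G \<times> verts G) \<and>
     (\<forall>v\<in>verts G. label G v \<in> carrier_vec \<delta>)"

text \<open>The fields \<open>matA\<close>, \<open>matB\<close>, \<open>bias\<close> and \<open>act\<close> are only used at layers \<open>1, \<dots>, L\<close>
  where \<open>L = layers N\<close>.\<close>

record 'c gnn =
  layers :: nat
  dims :: "nat \<Rightarrow> nat"
  matA :: "nat \<Rightarrow> real mat"
  matB :: "nat \<Rightarrow> 'c \<Rightarrow> real mat"
  bias :: "nat \<Rightarrow> real vec"
  act :: "nat \<Rightarrow> real \<Rightarrow> real"
  threshold :: real

definition is_sum_gnn :: "'c set \<Rightarrow> nat \<Rightarrow> 'c gnn \<Rightarrow> bool" where
  "is_sum_gnn Col \<delta> N \<longleftrightarrow>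
     1 \<le> layers N \<and> dims N 0 = \<delta> \<and> dims N (layers N) = \<delta> \<and>
     (\<forall>l\<in>{1..layers N}.
        matA N l \<in> carrier_mat (dims N l) (dims N (l - 1)) \<and>
        (\<forall>c\<in>Col. matB N l c \<in> carrier_mat (dims N l) (dims N (l - 1))) \<and>
        bias N l \<in> carrier_vec (dims N l) \<and>
        (\<forall>x. 0 \<le> act N l x) \<and> mono (act N l))"

fun feature :: "'c set \<Rightarrow> 'c gnn \<Rightarrow> ('v, 'c) graph \<Rightarrow> nat \<Rightarrow> 'v \<Rightarrow> real vec" where
  "feature Col N G 0 v = label G v"
| "feature Col N G (Suc l) v = map_vec (act N (Suc l))
     (bias N (Suc l) + matA N (Suc l) *\<^sub>v feature Col N G l v +
      finsum_vec TYPE(real) (dims N (Suc l))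
        (\<lambda>c. matB N (Suc l) c *\<^sub>v
           finsum_vec TYPE(real) (dims N l) (\<lambda>u. feature Col N G l u) {u. (v, u) \<in> edges G c})
        Col)"

definition cls :: "real \<Rightarrow> real \<Rightarrow> real" where
  "cls t x = (if t \<le> x then 1 else 0)"

definition apply_gnn :: "'c set \<Rightarrow> 'c gnn \<Rightarrow> ('v, 'c) graph \<Rightarrow> ('v, 'c) graph" where
  "apply_gnn Col N G =
     G\<lparr>label := \<lambda>v. map_vec (cls (threshold N)) (feature Col N G (layers N) v)\<rparr>"


section \<open>The dataset transformation of a sum-GNN\<close>

text \<open>The vertex of a constant is the constant itself.\<close>

definition enc :: "nat \<Rightarrow> 'c atom set \<Rightarrow> (const, 'c) graph" where
  "enc \<delta> D = \<lparr>
     verts = dataset_consts D,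
     edges = (\<lambda>c. {(a, b). Binary c (Const a) (Const b) \<in> D}),
     label = (\<lambda>a. vec \<delta> (\<lambda>p. if Unary p (Const a) \<in> D then 1 else 0))\<rparr>"

definition dec :: "'c set \<Rightarrow> nat \<Rightarrow> (const, 'c) graph \<Rightarrow> 'c atom set" where
  "dec Col \<delta> G =
     {Binary c (Const a) (Const b) | c a b. c \<in> Col \<and> (a, b) \<in> edges G c} \<union>
     {Unary p (Const a) | p a. p < \<delta> \<and> a \<in> verts G \<and> label G a $ p = 1}"

definition T_gnn :: "'c set \<Rightarrow> nat \<Rightarrow> 'c gnn \<Rightarrow> 'c atom set \<Rightarrow> 'c atom set" where
  "T_gnn Col \<delta> N D = dec Col \<delta> (apply_gnn Col N (enc \<delta> D))"

definition sound :: "'c set \<Rightarrow> nat \<Rightarrow> 'c rule \<Rightarrow> ('c atom set \<Rightarrow> 'c atom set) \<Rightarrow> bool" where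
  "sound Col \<delta> r T \<longleftrightarrow> (\<forall>D. is_dataset Col \<delta> D \<longrightarrow> T_rule r D \<subseteq> T D)"

lemma finite_atom_consts: "finite (atom_consts A)"
proof -
  have "finite (trm_consts t)" for t by (cases t) auto
  then show ?thesis by (cases A) auto
qed

lemma is_graph_enc:
  assumes "is_dataset Col \<delta> D"
  shows "is_graph Col \<delta> (enc \<delta> D)"
  using assms finite_atom_consts
  by (force simp: is_graph_def is_dataset_def enc_def dataset_consts_def)


section \<open>Safe channels\<close>

fun safe :: "'c set \<Rightarrow> 'c gnn \<Rightarrow> nat \<Rightarrow> nat \<Rightarrow> bool" where
  "safe Col N 0 i \<longleftrightarrow> i < dims N 0"
| "safe Col N (Suc l) i \<longleftrightarrow>
     i < dims N (Suc l) \<and>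
     (\<forall>M \<in> insert (matA N (Suc l)) (matB N (Suc l) ` Col).
        \<forall>j < dims N l. 0 \<le> M $$ (i, j) \<and> (\<not> safe Col N l j \<longrightarrow> M $$ (i, j) = 0))"

end

(*
  Restricting a satisfied rule body to the variables of the rule gives a substitution nu.
  Renaming the constants of nu that do not occur in the rule injectively into S gives one of
  the test substitutions, nu'.  Undoing this renaming embeds body_dataset r nu' into D, and the
  embedding is injective on constants, so distinct neighbours stay distinct.  Along such an
  embedding the value of a safe channel can only grow: its coefficients are non-negative, it
  ignores unsafe channels, and the additional neighbours contribute non-negative summands.
*)

theory Submission
  imports Defs
begin

section \<open>Monotonicity of safe channels under embeddings\<close>

text \<open>Sums over infinite sets take a default value, so both the entrywise reading and the
  comparison of neighbour sums rest on this.\<close>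

lemma finite_neighbours:
  assumes "is_graph Col \<delta> G" "c \<in> Col"
  shows "finite {u. (v, u) \<in> edges G c}"
  using assms by (auto simp: is_graph_def intro: finite_subset[of _ "verts G"])

text \<open>Labels are constrained only on vertices; the induction stays there because edges with a
  colour in \<open>Col\<close> end in vertices.\<close>

lemma feature_carrier:
  assumes "is_sum_gnn Col \<delta> N" "is_graph Col \<delta> G" "l \<le> layers N" "v \<in> verts G"
  shows "feature Col N G l v \<in> carrier_vec (dims N l)"
  using assms(3,4)
proof (induction l arbitrary: v)
  case 0
  then show ?case using assms(1,2) by (auto simp: is_graph_def is_sum_gnn_def)
next
  case (Suc l)
  have "Suc l \<in> {1..layers N}" using Suc.prems by simp
  then have A: "matA N (Suc l) \<in> carrier_mat (dims N (Suc l)) (dims N l)"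
    and B: "\<And>c. c \<in> Col \<Longrightarrow> matB N (Suc l) c \<in> carrier_mat (dims N (Suc l)) (dims N l)"
    and b: "bias N (Suc l) \<in> carrier_vec (dims N (Suc l))"
    using assms(1) unfolding is_sum_gnn_def by fastforce+
  have "finsum_vec TYPE(real) (dims N l) (feature Col N G l) {u. (v, u) \<in> edges G c}
      \<in> carrier_vec (dims N l)" if "c \<in> Col" for c
    using Suc assms(2) that by (intro finsum_vec_closed) (auto simp: is_graph_def)
  with B have "finsum_vec TYPE(real) (dims N (Suc l))
      (\<lambda>c. matB N (Suc l) c *\<^sub>v
        finsum_vec TYPE(real) (dims N l) (feature Col N G l) {u. (v, u) \<in> edges G c}) Col
      \<in> carrier_vec (dims N (Suc l))"
    by (intro finsum_vec_closed Pi_I mult_mat_vec_carrier) auto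
  moreover have "feature Col N G l v \<in> carrier_vec (dims N l)"
    using Suc by simp
  ultimately show ?case
    using A b unfolding feature.simps map_carrier_vec
    by (intro add_carrier_vec mult_mat_vec_carrier)
qed

text \<open>Safety constrains single matrix entries in row \<open>i\<close>, so the vector recursion
  is unfolded into a scalar formula that exhibits these entries as coefficients.\<close>

lemma feature_Suc_index:
  assumes fin: "finite Col" and N: "is_sum_gnn Col \<delta> N" and G: "is_graph Col \<delta> G"
    and l: "Suc l \<le> layers N" and v: "v \<in> verts G" and i: "i < dims N (Suc l)"
  shows "feature Col N G (Suc l) v $ i = act N (Suc l)
    (bias N (Suc l) $ i + (\<Sum>j<dims N l. matA N (Suc l) $$ (i, j) * feature Col N G l v $ j) +
     (\<Sum>c\<in>Col. \<Sum>j<dims N l. matB N (Suc l) c $$ (i, j) *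
        (\<Sum>u | (v, u) \<in> edges G c. feature Col N G l u $ j)))"
proof -
  have "Suc l \<in> {1..layers N}" using l by simp
  then have A: "matA N (Suc l) \<in> carrier_mat (dims N (Suc l)) (dims N l)"
    and B: "\<And>c. c \<in> Col \<Longrightarrow> matB N (Suc l) c \<in> carrier_mat (dims N (Suc l)) (dims N l)"
    using N unfolding is_sum_gnn_def by fastforce+
  have F: "feature Col N G l u \<in> carrier_vec (dims N l)" if "u \<in> verts G" for u
    using feature_carrier[OF N G _ that] l by simp
  have nb: "u \<in> verts G" if "(v, u) \<in> edges G c" "c \<in> Col" for u c
    using that G by (auto simp: is_graph_def)
  define T where "T c = finsum_vec TYPE(real) (dims N l) (feature Col N G l)
    {u. (v, u) \<in> edges G c}" for c
  have T: "T c \<in> carrier_vec (dims N l)" if "c \<in> Col" for c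
    unfolding T_def using that F nb by (intro finsum_vec_closed) auto
  have BT: "(\<lambda>c. matB N (Suc l) c *\<^sub>v T c) \<in> Col \<rightarrow> carrier_vec (dims N (Suc l))"
    using B T by (intro Pi_I mult_mat_vec_carrier) auto
  have Ti: "T c $ j = (\<Sum>u | (v, u) \<in> edges G c. feature Col N G l u $ j)"
    if "c \<in> Col" "j < dims N l" for c j
    unfolding T_def using that F nb finite_neighbours[OF G, of c v]
    by (intro index_finsum_vec) auto
  have mult: "(M *\<^sub>v x) $ i = (\<Sum>j<dims N l. M $$ (i, j) * x $ j)"
    if "M \<in> carrier_mat (dims N (Suc l)) (dims N l)" "x \<in> carrier_vec (dims N l)"
    for M and x :: "real vec"
    using that i by (auto simp: scalar_prod_def lessThan_atLeast0 intro!: sum.cong)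
  have "(finsum_vec TYPE(real) (dims N (Suc l)) (\<lambda>c. matB N (Suc l) c *\<^sub>v T c) Col) $ i =
      (\<Sum>c\<in>Col. (matB N (Suc l) c *\<^sub>v T c) $ i)"
    by (rule index_finsum_vec[OF fin i BT])
  also have "\<dots> = (\<Sum>c\<in>Col. \<Sum>j<dims N l. matB N (Suc l) c $$ (i, j) *
        (\<Sum>u | (v, u) \<in> edges G c. feature Col N G l u $ j))"
    using mult[OF B T] by (intro sum.cong) (auto simp: Ti)
  finally have S: "(finsum_vec TYPE(real) (dims N (Suc l))
      (\<lambda>c. matB N (Suc l) c *\<^sub>v T c) Col) $ i = \<dots>" .
  \<comment> \<open>Entrywise rules for \<open>+\<close> and \<open>map_vec\<close> require the
    index to lie below the dimension of the vector, here of the right-hand summand.\<close>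
  have "dim_vec (finsum_vec TYPE(real) (dims N (Suc l))
      (\<lambda>c. matB N (Suc l) c *\<^sub>v T c) Col) = dims N (Suc l)"
    using finsum_vec_closed[OF BT] by auto
  then show ?thesis
    using i A mult[OF A F[OF v]] S by (simp add: T_def)
qed

text \<open>Layer 0 is covered by the labels, every later layer by the non-negative range of the
  activation; this concerns unsafe channels as well.\<close>

lemma feature_nonneg:
  assumes "finite Col" "is_sum_gnn Col \<delta> N" "is_graph Col \<delta> G"
    and "\<And>v p. v \<in> verts G \<Longrightarrow> p < \<delta> \<Longrightarrow> 0 \<le> label G v $ p"
    and "l \<le> layers N" "v \<in> verts G" "i < dims N l"
  shows "0 \<le> feature Col N G l v $ i"
proof (cases l)
  case 0
  then show ?thesis using assms by (simp add: is_sum_gnn_def)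
next
  case (Suc k)
  then have "l \<in> {1..layers N}" using assms(5) by simp
  then have "0 \<le> act N l x" for x using assms(2) by (simp add: is_sum_gnn_def)
  then show ?thesis
    using assms Suc by (simp add: feature_Suc_index del: feature.simps)
qed

text \<open>The induction on the layer treats all safe channels at once, since a safe channel reads
  other safe channels of the layer below. The map \<open>h\<close> only has to preserve edges, not
  reflect them, and labels may grow along it.\<close>

lemma safe_feature_mono:
  assumes fin: "finite Col" and N: "is_sum_gnn Col \<delta> N"
    and G: "is_graph Col \<delta> G" and H: "is_graph Col \<delta> H"
    and inj: "inj_on h (verts G)" and h: "h ` verts G \<subseteq> verts H"
    and edges: "\<And>c v u. c \<in> Col \<Longrightarrow> (v, u) \<in> edges G c \<Longrightarrow> (h v, h u) \<in> edges H c"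
    and labels: "\<And>v p. v \<in> verts G \<Longrightarrow> p < \<delta> \<Longrightarrow> label G v $ p \<le> label H (h v) $ p"
    and nonneg: "\<And>v p. v \<in> verts H \<Longrightarrow> p < \<delta> \<Longrightarrow> 0 \<le> label H v $ p"
    and "l \<le> layers N" "safe Col N l i" "v \<in> verts G"
  shows "feature Col N G l v $ i \<le> feature Col N H l (h v) $ i"
  using assms(10-12)
proof (induction l arbitrary: i v)
  case 0
  then show ?case using labels N by (simp add: is_sum_gnn_def)
next
  case (Suc l)
  have "Suc l \<in> {1..layers N}" using Suc.prems by simp
  then have mono: "mono (act N (Suc l))" using N by (simp add: is_sum_gnn_def)
  have i: "i < dims N (Suc l)" using Suc.prems by simp
  have hv: "h v \<in> verts H" using h Suc.prems by auto
  have safe: "0 \<le> M $$ (i, j) \<and> (\<not> safe Col N l j \<longrightarrow> M $$ (i, j) = 0)"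
    if "M \<in> insert (matA N (Suc l)) (matB N (Suc l) ` Col)" "j < dims N l" for M j
    using Suc.prems(2) that by auto
  \<comment> \<open>The comparison of \<open>x\<close> and \<open>y\<close> is demanded only for
    safe \<open>j\<close>; for unsafe \<open>j\<close> the coefficient is zero and both sides
    vanish.\<close>
  have coeff: "M $$ (i, j) * x \<le> M $$ (i, j) * y"
    if "M \<in> insert (matA N (Suc l)) (matB N (Suc l) ` Col)" "j < dims N l"
      "safe Col N l j \<Longrightarrow> x \<le> y" for M j x y
    using safe[OF that(1,2)] that(3) by (cases "safe Col N l j") (auto intro: mult_left_mono)
  have IH: "feature Col N G l u $ j \<le> feature Col N H l (h u) $ j"
    if "safe Col N l j" "u \<in> verts G" for u j
    using Suc.IH Suc.prems(1) that by simp
  have neighbours: "(\<Sum>u | (v, u) \<in> edges G c. feature Col N G l u $ j)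
      \<le> (\<Sum>u | (h v, u) \<in> edges H c. feature Col N H l u $ j)"
    if c: "c \<in> Col" and j: "j < dims N l" and s: "safe Col N l j" for c j
  proof -
    have sub: "{u. (v, u) \<in> edges G c} \<subseteq> verts G" "{u. (h v, u) \<in> edges H c} \<subseteq> verts H"
      using G H c by (auto simp: is_graph_def)
    have "(\<Sum>u | (v, u) \<in> edges G c. feature Col N G l u $ j)
        \<le> (\<Sum>u | (v, u) \<in> edges G c. feature Col N H l (h u) $ j)"
      using sub s by (intro sum_mono IH) auto
    \<comment> \<open>Injectivity of \<open>h\<close> ensures that no two neighbours of
      \<open>v\<close> merge into a single summand.\<close>
    also have "\<dots> = (\<Sum>u \<in> h ` {u. (v, u) \<in> edges G c}. feature Col N H l u $ j)"
      using inj_on_subset[OF inj sub(1)] by (simp add: sum.reindex)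
    \<comment> \<open>Images of neighbours of \<open>v\<close> are neighbours of \<open>h v\<close>;
      the remaining neighbours of \<open>h v\<close> contribute non-negative terms.\<close>
    also have "\<dots> \<le> (\<Sum>u | (h v, u) \<in> edges H c. feature Col N H l u $ j)"
      using finite_neighbours[OF H c] edges c sub(2) j Suc.prems(1)
      by (intro sum_mono2) (auto intro!: feature_nonneg[OF fin N H nonneg])
    finally show ?thesis .
  qed
  show ?case
    \<comment> \<open>Both sides share bias and coefficients, so the arguments of the monotone
      activation are compared summand by summand.\<close>
    unfolding feature_Suc_index[OF fin N G Suc.prems(1,3) i]
      feature_Suc_index[OF fin N H Suc.prems(1) hv i]
    using Suc.prems(3)
    by (intro monoD[OF mono] add_mono order_refl sum_mono coeff neighbours IH) auto
qed

text \<open>Reduces derivability of a unary fact to a threshold test on one real number, to which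
  monotonicity of features applies.\<close>

lemma T_gnn_unary_iff:
  assumes "is_sum_gnn Col \<delta> N" "is_dataset Col \<delta> D" "p < \<delta>"
  shows "Unary p (Const a) \<in> T_gnn Col \<delta> N D \<longleftrightarrow>
    a \<in> dataset_consts D \<and> threshold N \<le> feature Col N (enc \<delta> D) (layers N) a $ p"
proof (cases "a \<in> dataset_consts D")
  case True
  then have "feature Col N (enc \<delta> D) (layers N) a \<in> carrier_vec \<delta>"
    using feature_carrier[OF assms(1) is_graph_enc[OF assms(2)], of "layers N" a] assms(1)
    by (simp add: is_sum_gnn_def enc_def)
  then show ?thesis
    using True assms(3) by (auto simp: T_gnn_def dec_def apply_gnn_def cls_def enc_def)
qed (auto simp: T_gnn_def dec_def apply_gnn_def enc_def)

text \<open>Initial labels are 0/1 indicators of unary facts, so mapping facts of \<open>D\<close>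
  to facts of \<open>E\<close> gives a label-increasing, edge-preserving map between the encodings.
  A feature that reaches the threshold then still reaches it at the image vertex.\<close>

lemma T_gnn_mono_embedding:
  assumes fin: "finite Col" and N: "is_sum_gnn Col \<delta> N"
    and D: "is_dataset Col \<delta> D" and E: "is_dataset Col \<delta> E"
    and inj: "inj_on h (dataset_consts D)"
    and unary: "\<And>q a. Unary q (Const a) \<in> D \<Longrightarrow> Unary q (Const (h a)) \<in> E"
    and binary: "\<And>c a b. Binary c (Const a) (Const b) \<in> D \<Longrightarrow>
      Binary c (Const (h a)) (Const (h b)) \<in> E"
    and p: "p < \<delta>" and safe: "safe Col N (layers N) p"
    and a: "Unary p (Const a) \<in> T_gnn Col \<delta> N D"
  shows "Unary p (Const (h a)) \<in> T_gnn Col \<delta> N E"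
proof -
  \<comment> \<open>Vertices are exactly the constants occurring in some fact, and the image of that
    fact in \<open>E\<close> contains \<open>h x\<close>.\<close>
  have h: "h x \<in> dataset_consts E" if x: "x \<in> dataset_consts D" for x
  proof -
    obtain A where A: "A \<in> D" "x \<in> atom_consts A" using x by (auto simp: dataset_consts_def)
    then have "is_fact A" using D by (auto simp: is_dataset_def)
    show ?thesis
    proof (cases A)
      case (Unary q t)
      then show ?thesis using A \<open>is_fact A\<close> unary
        by (cases t) (force simp: is_fact_def dataset_consts_def)+
    next
      case (Binary c s t)
      then obtain y z where yz: "A = Binary c (Const y) (Const z)"
        using \<open>is_fact A\<close> by (cases s; cases t) (auto simp: is_fact_def)
      then have "Binary c (Const (h y)) (Const (h z)) \<in> E" using A binary by simp
      then show ?thesis using A yz by (force simp: dataset_consts_def)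
    qed
  qed
  have "feature Col N (enc \<delta> D) (layers N) a $ p
      \<le> feature Col N (enc \<delta> E) (layers N) (h a) $ p"
    if "a \<in> dataset_consts D"
    using that h inj unary binary
    by (intro safe_feature_mono[OF fin N is_graph_enc[OF D] is_graph_enc[OF E] _ _ _ _ _ _ safe])
      (auto simp: enc_def)
  then show ?thesis
    using a h by (fastforce simp: T_gnn_unary_iff[OF N D p] T_gnn_unary_iff[OF N E p])
qed


section \<open>Rule bodies as datasets\<close>

lemma finite_atom_vars: "finite (atom_vars A)"
proof -
  have "finite (trm_vars t)" for t by (cases t) auto
  then show ?thesis by (cases A) auto
qed

lemma finite_rule_vars: "is_rule Col \<delta> r \<Longrightarrow> finite (rule_vars r)"
proof -
  assume r: "is_rule Col \<delta> r"
  have "rule_vars r \<subseteq> (\<Union>B\<in>set (body r). case B of Atom A \<Rightarrow> atom_vars A | _ \<Rightarrow> {})"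
    using r by (force simp: is_rule_def)
  then show ?thesis
    by (rule finite_subset) (auto simp: finite_atom_vars split: literal.split)
qed

lemma subst_trm_Const:
  assumes "trm_vars t \<subseteq> dom \<nu>"
  obtains a where "subst_trm \<nu> t = Const a"
  using assms by (cases t) auto

lemma is_dataset_body_dataset:
  assumes r: "is_rule Col \<delta> r" and \<nu>: "rule_vars r \<subseteq> dom \<nu>"
  shows "is_dataset Col \<delta> (body_dataset r \<nu>)"
proof -
  have "body_dataset r \<nu> \<subseteq> (\<Union>B\<in>set (body r). case B of Atom A \<Rightarrow> {subst_atom \<nu> A} | _ \<Rightarrow> {})"
    by (force simp: body_dataset_def)
  then have "finite (body_dataset r \<nu>)"
    by (rule finite_subset) (auto split: literal.split)
  moreover have "is_fact (subst_atom \<nu> A) \<and> atom_in_sig Col \<delta> (subst_atom \<nu> A)"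
    if A: "Atom A \<in> set (body r)" for A
  proof -
    have sig: "atom_in_sig Col \<delta> A" using r A by (auto simp: is_rule_def)
    have "atom_vars A \<subseteq> dom \<nu>" using \<nu> A by (force simp: rule_vars_def)
    moreover have "trm_vars (subst_trm \<nu> t) = {}" if "trm_vars t \<subseteq> dom \<nu>" for t
      using subst_trm_Const[OF that] by (metis trm_vars.simps(2))
    ultimately show ?thesis using sig by (cases A) (auto simp: is_fact_def)
  qed
  ultimately show ?thesis by (auto simp: is_dataset_def body_dataset_def)
qed

text \<open>A variable outside the domain would survive in the instance of a body atom, but members
  of a dataset are variable-free.\<close>

lemma satisfying_subst_total:
  assumes D: "is_dataset Col \<delta> D" and r: "is_rule Col \<delta> r"
    and sat: "\<forall>B\<in>set (body r). satisfies D (subst_literal \<nu> B)"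
  shows "rule_vars r \<subseteq> dom \<nu>"
proof
  fix x assume "x \<in> rule_vars r"
  then obtain A where A: "Atom A \<in> set (body r)" "x \<in> atom_vars A"
    using r by (auto simp: is_rule_def)
  then have "is_fact (subst_atom \<nu> A)" using sat D by (force simp: is_dataset_def)
  moreover have "x \<in> dom \<nu>" if "x \<in> trm_vars t" "trm_vars (subst_trm \<nu> t) = {}" for t
    using that by (cases t) (auto split: option.splits)
  ultimately show "x \<in> dom \<nu>" using A(2) by (cases A) (auto simp: is_fact_def)
qed

text \<open>Body atoms hold in the body dataset by construction, so only the inequalities remain as
  a condition for the rule to fire there.\<close>

lemma T_ruleI_body_dataset:
  assumes "is_rule Col \<delta> r" "dom \<nu> = rule_vars r"
    and "\<forall>s u. Neq s u \<in> set (body r) \<longrightarrow>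
      satisfies (body_dataset r \<nu>) (subst_literal \<nu> (Neq s u))"
  shows "subst_atom \<nu> (head r) \<in> T_rule r (body_dataset r \<nu>)"
proof -
  have "satisfies (body_dataset r \<nu>) (subst_literal \<nu> B)" if B: "B \<in> set (body r)" for B
  proof (cases B)
    case (Atom A)
    then show ?thesis using B by (auto simp: body_dataset_def)
  next
    case (Neq s u)
    then show ?thesis using B assms(3) by blast
  qed
  then show ?thesis using assms(2) finite_rule_vars[OF assms(1)] by (auto simp: T_rule_def)
qed

text \<open>Elements of \<open>C\<close> stay fixed and the rest of \<open>Y\<close> goes
  injectively into \<open>S\<close>; disjointness of \<open>S\<close> and \<open>C\<close> prevents
  collisions between the two kinds of values.\<close>

lemma renaming_into:
  assumes "finite S" "finite Y" "card Y \<le> card S" "S \<inter> C = {}"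
  obtains f where "inj_on f (Y \<union> C)" "f ` (Y \<union> C) \<subseteq> S \<union> C" "\<And>a. a \<in> C \<Longrightarrow> f a = a"
proof -
  obtain f0 where f0: "inj_on f0 Y" "f0 ` Y \<subseteq> S"
    using card_le_inj[OF assms(2,1,3)] by blast
  \<comment> \<open>\<open>Y\<close> and \<open>C\<close> may overlap; on the overlap the identity
    takes precedence over \<open>f0\<close>.\<close>
  define f where "f a = (if a \<in> C then a else f0 a)" for a
  have disj: "f0 a \<notin> C" if "a \<in> Y" for a using that f0(2) assms(4) by blast
  have "inj_on f (Y \<union> C)"
  proof (rule inj_onI)
    fix x y assume "x \<in> Y \<union> C" "y \<in> Y \<union> C" "f x = f y"
    then show "x = y"
      using disj inj_onD[OF f0(1), of x y]
      by (cases "x \<in> C"; cases "y \<in> C") (auto simp: f_def)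
  qed
  moreover have "f ` (Y \<union> C) \<subseteq> S \<union> C" using f0 by (auto simp: f_def)
  ultimately show thesis using that by (simp add: f_def)
qed

section \<open>Reduction of soundness to finitely many test substitutions\<close>

theorem proposition4:
  fixes Col :: "'c set" and \<delta> p :: nat and N :: "'c gnn" and r :: "'c rule"
    and t :: trm and S :: "const set"
  assumes "finite Col" and "1 \<le> \<delta>"
    and "is_sum_gnn Col \<delta> N"
    and "is_rule Col \<delta> r"
    and "p < \<delta>" and "head r = Unary p t"
    and "finite S" and "card S = card (rule_vars r)"
    and "S \<inter> rule_consts r = {}"
    and "safe Col N (layers N) p"
  shows "sound Col \<delta> r (T_gnn Col \<delta> N) \<longleftrightarrow>
    (\<forall>\<nu>. dom \<nu> = rule_vars r \<and> ran \<nu> \<subseteq> S \<union> rule_consts r \<and>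
         (\<forall>s u. Neq s u \<in> set (body r) \<longrightarrow>
            satisfies (body_dataset r \<nu>) (subst_literal \<nu> (Neq s u)))
       \<longrightarrow> subst_atom \<nu> (head r) \<in> T_gnn Col \<delta> N (body_dataset r \<nu>))"
proof (intro iffI allI impI)
  fix \<nu>
  assume "sound Col \<delta> r (T_gnn Col \<delta> N)"
    and "dom \<nu> = rule_vars r \<and> ran \<nu> \<subseteq> S \<union> rule_consts r \<and>
      (\<forall>s u. Neq s u \<in> set (body r) \<longrightarrow>
        satisfies (body_dataset r \<nu>) (subst_literal \<nu> (Neq s u)))"
  \<comment> \<open>Soundness is applied to the body dataset itself, on which the rule fires under
    \<open>\<nu>\<close>.\<close>
  then show "subst_atom \<nu> (head r) \<in> T_gnn Col \<delta> N (body_dataset r \<nu>)"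
    using T_ruleI_body_dataset[OF assms(4)] is_dataset_body_dataset[OF assms(4), of \<nu>]
    unfolding sound_def by blast
next
  assume test: "\<forall>\<nu>. dom \<nu> = rule_vars r \<and> ran \<nu> \<subseteq> S \<union> rule_consts r \<and>
         (\<forall>s u. Neq s u \<in> set (body r) \<longrightarrow>
            satisfies (body_dataset r \<nu>) (subst_literal \<nu> (Neq s u)))
       \<longrightarrow> subst_atom \<nu> (head r) \<in> T_gnn Col \<delta> N (body_dataset r \<nu>)"
  have "subst_atom \<nu> (head r) \<in> T_gnn Col \<delta> N D"
    if D: "is_dataset Col \<delta> D"
      and sat: "\<forall>B\<in>set (body r). satisfies D (subst_literal \<nu> B)" for D \<nu>
  proof -
    have dom: "rule_vars r \<subseteq> dom \<nu>"
      by (rule satisfying_subst_total[OF D assms(4) sat])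
    \<comment> \<open>\<open>Y\<close> collects the values of the rule variables, at most as many as
      \<open>S\<close> has elements; \<open>X\<close> adds the rule constants and so contains every
      constant of the instantiated rule.\<close>
    define Y where "Y = (\<lambda>x. the (\<nu> x)) ` rule_vars r"
    define X where "X = Y \<union> rule_consts r"
    have "finite Y" "card Y \<le> card S"
      using finite_rule_vars[OF assms(4)] assms(8) by (auto simp: Y_def card_image_le)
    then obtain f where inj: "inj_on f X" and f: "f ` X \<subseteq> S \<union> rule_consts r"
      and fix_consts: "\<And>a. a \<in> rule_consts r \<Longrightarrow> f a = a"
      using renaming_into[OF assms(7) _ _ assms(9), of Y] unfolding X_def by metis
    define g where "g = inv_into X f"
    \<comment> \<open>The test substitution is \<open>\<nu>\<close> followed by the renaming, cut
      down to the rule variables because \<open>\<nu>\<close> may be defined on more.\<close>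
    define \<nu>' where "\<nu>' x = (if x \<in> rule_vars r then Some (f (the (\<nu> x))) else None)" for x
    \<comment> \<open>Every term of the rule, constant or variable, is instantiated compatibly:
      \<open>f\<close> leads from its value under \<open>\<nu>\<close> to that under
      \<open>\<nu>'\<close>, and \<open>g\<close> leads back. For constants this uses that
      \<open>f\<close> fixes them.\<close>
    have subst: "\<exists>b\<in>X. subst_trm \<nu> s = Const b \<and> subst_trm \<nu>' s = Const (f b) \<and> g (f b) = b"
      if "trm_vars s \<subseteq> rule_vars r" "trm_consts s \<subseteq> rule_consts r" for s
    proof (cases s)
      case (Var x)
      then have "x \<in> rule_vars r" using that by simp
      moreover from this obtain b where "\<nu> x = Some b" using dom by blast
      ultimately show ?thesis using Var inj
        by (force simp: \<nu>'_def g_def X_def Y_def image_iff)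
    next
      case (Const a)
      then show ?thesis using that fix_consts[of a] inv_into_f_f[OF inj, of a]
        by (auto simp: g_def X_def)
    qed
    have lits: "literal_vars B \<subseteq> rule_vars r" "literal_consts B \<subseteq> rule_consts r"
      if "B \<in> set (body r)" for B
      using that by (auto simp: rule_vars_def rule_consts_def)
    have dom': "dom \<nu>' = rule_vars r" by (auto simp: \<nu>'_def split: if_splits)
    have ran': "ran \<nu>' \<subseteq> S \<union> rule_consts r"
      using f by (auto simp: ran_def \<nu>'_def X_def Y_def split: if_splits)
    have neq': "satisfies (body_dataset r \<nu>') (subst_literal \<nu>' (Neq s u))"
      if su: "Neq s u \<in> set (body r)" for s u
    proof -
      obtain b where b: "b \<in> X" "subst_trm \<nu> s = Const b" "subst_trm \<nu>' s = Const (f b)"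
        using subst[of s] lits[OF su] by auto
      obtain c where c: "c \<in> X" "subst_trm \<nu> u = Const c" "subst_trm \<nu>' u = Const (f c)"
        using subst[of u] lits[OF su] by auto
      \<comment> \<open>The inequality holds under \<open>\<nu>\<close>, and injectivity of
        \<open>f\<close> on \<open>X\<close> carries it over to \<open>\<nu>'\<close>.\<close>
      have "b \<noteq> c" using sat su b c by fastforce
      then show ?thesis using b c inj by (simp add: inj_on_eq_iff)
    qed
    have test': "subst_atom \<nu>' (head r) \<in> T_gnn Col \<delta> N (body_dataset r \<nu>')"
      using test dom' ran' neq' by blast
    have D': "is_dataset Col \<delta> (body_dataset r \<nu>')"
      using is_dataset_body_dataset[OF assms(4)] dom' by simp
    \<comment> \<open>An inverse is injective only on the image of \<open>X\<close> under
      \<open>f\<close>, so all constants of the test dataset must lie there.\<close>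
    have "dataset_consts (body_dataset r \<nu>') \<subseteq> f ` X"
    proof
      fix a assume "a \<in> dataset_consts (body_dataset r \<nu>')"
      then obtain A where A: "Atom A \<in> set (body r)" "a \<in> atom_consts (subst_atom \<nu>' A)"
        by (auto simp: dataset_consts_def body_dataset_def)
      then obtain s where "trm_vars s \<subseteq> rule_vars r" "trm_consts s \<subseteq> rule_consts r"
        "a \<in> trm_consts (subst_trm \<nu>' s)"
        using lits[OF A(1)] by (cases A) auto
      then show "a \<in> f ` X" using subst by fastforce
    qed
    then have inj_g: "inj_on g (dataset_consts (body_dataset r \<nu>'))"
      unfolding g_def by (rule inj_on_inv_into)
    have atoms: "subst_atom \<nu> A \<in> D" if "Atom A \<in> set (body r)" for A
      using sat that by fastforce
    \<comment> \<open>A unary fact of the test dataset stems from a unary body atom; undoing the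
      renaming yields its instance under \<open>\<nu>\<close>, which lies in
      \<open>D\<close>.\<close>
    have unary: "Unary q (Const (g a)) \<in> D"
      if A: "Unary q (Const a) \<in> body_dataset r \<nu>'" for q a
    proof -
      obtain s where s: "Atom (Unary q s) \<in> set (body r)" "subst_trm \<nu>' s = Const a"
        using A unfolding body_dataset_def
        by clarsimp (metis atom.distinct(1) atom.inject(1) subst_atom.elims)
      then have "subst_trm \<nu> s = Const (g a)"
        using subst[of s] lits[OF s(1)] by auto
      then show ?thesis using atoms[OF s(1)] by simp
    qed
    have binary: "Binary c (Const (g a)) (Const (g b)) \<in> D"
      if A: "Binary c (Const a) (Const b) \<in> body_dataset r \<nu>'" for c a b
    proof -
      obtain s u where s: "Atom (Binary c s u) \<in> set (body r)" "subst_trm \<nu>' s = Const a"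
          "subst_trm \<nu>' u = Const b"
        using A unfolding body_dataset_def
        by clarsimp (metis atom.distinct(1) atom.inject(2) subst_atom.elims)
      then have "subst_trm \<nu> s = Const (g a)" "subst_trm \<nu> u = Const (g b)"
        using subst[of s] subst[of u] lits[OF s(1)] by auto
      then show ?thesis using atoms[OF s(1)] by simp
    qed
    have "trm_vars t \<subseteq> rule_vars r" "trm_consts t \<subseteq> rule_consts r"
      using assms(6) by (auto simp: rule_vars_def rule_consts_def)
    then obtain b where b: "subst_trm \<nu> t = Const b" "subst_trm \<nu>' t = Const (f b)" "g (f b) = b"
      using subst by blast
    then have "Unary p (Const (f b)) \<in> T_gnn Col \<delta> N (body_dataset r \<nu>')"
      using test' assms(6) by simp
    \<comment> \<open>The embedding \<open>g\<close> runs from the test dataset into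
      \<open>D\<close> and takes the derived head instance back to the one under
      \<open>\<nu>\<close>.\<close>
    then have "Unary p (Const (g (f b))) \<in> T_gnn Col \<delta> N D"
      using unary binary
      by (intro T_gnn_mono_embedding[OF assms(1,3) D' D inj_g _ _ assms(5,10)])
    then show ?thesis using b assms(6) by simp
  qed
  then show "sound Col \<delta> r (T_gnn Col \<delta> N)"
    by (auto simp: sound_def T_rule_def)
qed

end
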